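(* Let $G=(V,E)$ be a strongly connected Eulerian finite directed graph (loops and multiple edges allowed), fix an edge $e_*\in E$ and let $v_*=\mathtt{t}(e_* )$. Let $\phi:\mathbb{Z}^E\to\mathbb{Z}^V$ be the $\mathbb{Z}$-linear map with $\phi(e)=\mathtt{t}(e)$ for all $e\in E$. Then $\phi$ descends to a surjective group homomorphism $$\bar\phi: K(\mathcal{L}G,e_* )\to K(G,v_* ).$$ Moreover, if $k$ is a positive integer and $G$ is balanced $k$-regular, then $\ker(\bar\phi)$ is the $k$-torsion subgroup $\{g\in K(\mathcal{L}G,e_* ) : kg=0\}$ of $K(\mathcal{L}G,e_* )$.
   Context: A finite directed graph $G=(V,E)$ has source and target maps $\mathtt{s},\mathtt{t}:E\to V$; each edge $e$ is directed from $\mathtt{s}(e)$ to $\mathtt{t}(e)$. Loops and multiple edges are allowed. $\mathrm{indeg}(v)=\#\{e:\mathtt{t}(e)=v\}$ and $\mathrm{outdeg}(v)=\#\{e:\mathtt{s}(e)=v\}$. $G$ is strongly connected if for any $v,w\in V$ there are directed paths from $v$ to $w$ and from $w$ to $v$; Eulerian if $\mathrm{indeg}(v)=\mathrm{outdeg}(v)$ for all $v\in V$; balanced $k$-regular if $\mathrm{indeg}(v)=\mathrm{outdeg}(v)=k$ for all $v\in V$. The directed line graph $\mathcal{L}G=(E,E_2)$ has vertex set $E$ and edge set $E_2=\{(e_1,e_2)\in E\times E:\mathtt{s}(e_2)=\mathtt{t}(e_1)\}$, with $(e_1,e_2)$ directed from $e_1$ to $e_2$. Sandpile group: $\mathbb{Z}^V$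 is the free abelian group on $V$. For $v\in V$ let $\Delta_v=\sum_{\mathtt{s}(e)=v}(\mathtt{t}(e)-v)\in\mathbb{Z}^V$, the sum being over edges $e$ with source $v$. For a vertex $v_*$, let $L_V\subset\mathbb{Z}^V$ be the subgroup generated by $v_*$ and $\{\Delta_v\}_{v\ne v_*}$, and define $K(G,v_* )=\mathbb{Z}^V/L_V$. Applied to $\mathcal{L}G$ and its vertex $e_*$: for $e\in E$ let $\Delta_e=\sum_{\mathtt{s}(f)=\mathtt{t}(e)}(f-e)\in\mathbb{Z}^E$, let $L_E\subset\mathbb{Z}^E$ be the subgroup generated by $e_*$ and $\{\Delta_e\}_{e\ne e_*}$; then $K(\mathcal{L}G,e_* )=\mathbb{Z}^E/L_E$. "$\phi$ descends" means $\phi(L_E)\subset L_V$, so that $\phi$ induces a well-defined homomorphism $\bar\phi$ of the quotients. *)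

theory Defs
  imports "Graph_Theory.Digraph_Component" "HOL-Algebra.Free_Abelian_Groups"
begin

definition eulerian_digraph :: "('a, 'b) pre_digraph \<Rightarrow> bool" where
  "eulerian_digraph G \<longleftrightarrow> (\<forall>v \<in> verts G. in_degree G v = out_degree G v)"

definition balanced_regular :: "nat \<Rightarrow> ('a, 'b) pre_digraph \<Rightarrow> bool" where
  "balanced_regular k G \<longleftrightarrow> (\<forall>v \<in> verts G. in_degree G v = k \<and> out_degree G v = k)"

definition line_digraph :: "('a, 'b) pre_digraph \<Rightarrow> ('b, 'b \<times> 'b) pre_digraph" where
  "line_digraph G =
     \<lparr>verts = arcs G,
      arcs = {(e1, e2) \<in> arcs G \<times> arcs G. tail G e2 = head G e1},
      tail = fst, head = snd\<rparr>"

definition vertex_laplacian :: "('a, 'b) pre_digraph \<Rightarrow> 'a \<Rightarrow> ('a \<Rightarrow>\<^sub>0 int)" where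
  "vertex_laplacian G v = (\<Sum>e \<in> out_arcs G v. frag_of (head G e) - frag_of v)"

definition sandpile_lattice :: "('a, 'b) pre_digraph \<Rightarrow> 'a \<Rightarrow> ('a \<Rightarrow>\<^sub>0 int) set" where
  "sandpile_lattice G r =
     generate (free_Abelian_group (verts G))
       (insert (frag_of r) (vertex_laplacian G ` (verts G - {r})))"

text \<open>
  The ambient free abelian group is additive on finitely supported functions, but like every
  group of HOL-Algebra it is written multiplicatively. So \<open>g [^] k\<close> in the quotient is the
  multiple \<open>k g\<close>, and its unit \<open>\<one>\<close> is the class of \<open>0\<close>.
\<close>

definition sandpile_group :: "('a, 'b) pre_digraph \<Rightarrow> 'a \<Rightarrow> ('a \<Rightarrow>\<^sub>0 int) set monoid" where
  "sandpile_group G r = free_Abelian_group (verts G) Mod sandpile_lattice G r"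

definition head_map :: "('a, 'b) pre_digraph \<Rightarrow> ('b \<Rightarrow>\<^sub>0 int) \<Rightarrow> ('a \<Rightarrow>\<^sub>0 int)" where
  "head_map G = frag_extend (\<lambda>e. frag_of (head G e))"

end

theory Submission
  imports Defs
begin

text \<open>
  Write \<open>\<Delta>\<^sub>V\<close> and \<open>\<Delta>\<^sub>E\<close> for the linearly extended Laplacians of \<open>G\<close> and of its line digraph, \<open>\<phi>\<close> for
  the head map, and \<open>\<sigma>\<close> (\<open>out_arc_map\<close> below) for the linear map in the other direction that sends a
  vertex to the sum of its outgoing arcs.

  The Laplacian of the line digraph at an arc \<open>e\<close> is \<open>\<sigma> (\<phi> e) - d e\<close>, and the Laplacian of \<open>G\<close> at a
  vertex \<open>v\<close> is \<open>\<phi> (\<sigma> v) - d v\<close>, where \<open>d\<close> is the out-degree of the head of \<open>e\<close>, respectively of \<open>v\<close>.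
  Consequently \<open>\<phi> \<circ> \<Delta>\<^sub>E = \<Delta>\<^sub>V \<circ> \<phi>\<close> (\<open>head_map_laplacian_line_digraph\<close>).  In an Eulerian digraph
  the Laplacians of all vertices add up to \<open>0\<close>.  Hence the Laplacian at the root, which is
  left out of the generators of the sandpile lattice, belongs to the lattice all the same, and the
  lattice consists of the elements \<open>a r + \<Delta> c\<close> with \<open>r\<close> the root, \<open>a\<close> an integer and \<open>c\<close> arbitrary
  (\<open>sandpile_lattice_eulerian\<close>).  These two facts make \<open>\<phi>\<close> descend.  It is surjective because in a
  strongly connected digraph with an arc every vertex is the head of some arc.

  Now let \<open>G\<close> be balanced \<open>k\<close>-regular with \<open>k > 0\<close>.  Then the line digraph is Eulerian too, and the two
  Laplacians are \<open>\<Delta>\<^sub>V = \<phi> \<circ> \<sigma> - k\<close> and \<open>\<Delta>\<^sub>E = \<sigma> \<circ> \<phi> - k\<close>.  The claim about the kernel says that \<open>\<phi> x\<close>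
  lies in the lattice of \<open>G\<close> if and only if \<open>k x\<close> lies in the lattice of the line digraph
  (\<open>head_map_in_lattice_iff\<close>).  Let \<open>r\<close> be the root arc and \<open>v = \<phi> r\<close>.

  If \<open>\<phi> x = a v + \<Delta>\<^sub>V u\<close>, then applying \<open>\<sigma>\<close>, where \<open>\<sigma> \<circ> \<phi> = \<Delta>\<^sub>E + k\<close> and \<open>\<sigma> \<circ> \<Delta>\<^sub>V = \<Delta>\<^sub>E \<circ> \<sigma>\<close>, gives
  \<open>\<Delta>\<^sub>E x + k x = a (\<Delta>\<^sub>E r + k r) + \<Delta>\<^sub>E (\<sigma> u)\<close>, that is, \<open>k x = a k r + \<Delta>\<^sub>E (a r + \<sigma> u - x)\<close>.

  Conversely let \<open>k x = a r + \<Delta>\<^sub>E c\<close>.  The coefficients of \<open>\<Delta>\<^sub>E c\<close> add up to \<open>0\<close>, so \<open>a = k b\<close> with \<open>b\<close>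
  the sum of the coefficients of \<open>x\<close>, and \<open>k (x + c - b r) = \<sigma> (\<phi> c)\<close>.  The coefficient of \<open>\<sigma> w\<close> at an
  arc is the coefficient of \<open>w\<close> at its tail, and every vertex is a tail; so \<open>k\<close> divides \<open>\<phi> c\<close>, say
  \<open>\<phi> c = k u\<close>.  Cancelling \<open>k\<close> gives \<open>x + c - b r = \<sigma> u\<close>, and applying \<open>\<phi>\<close> gives
  \<open>\<phi> x = b v + (\<phi> (\<sigma> u) - k u) = b v + \<Delta>\<^sub>V u\<close>.
\<close>

section \<open>Linear maps between free abelian groups\<close>

lemma frag_extend_frag_extend:
  "frag_extend f (frag_extend g c) = frag_extend (\<lambda>x. frag_extend f (g x)) c"
  using subset_UNIV by (induction c rule: frag_induction) (simp_all add: frag_extend_diff)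

lemma frag_cmul_diff_distrib2: "frag_cmul k (x - y) = frag_cmul k x - frag_cmul k y"
  by (rule poly_mapping_eqI) (simp add: lookup_minus algebra_simps)

lemma sum_const_frag: "(\<Sum>i\<in>A. c) = frag_cmul (int (card A)) c"
  by (induction A rule: infinite_finite_induct) (auto simp: frag_cmul_distrib add.commute)

lemma frag_cmul_cancel:
  assumes "k \<noteq> 0" "frag_cmul k x = frag_cmul k y"
  shows "x = y"
  using assms by (metis frag_cmul_diff_distrib2 frag_cmul_eq_0_iff right_minus_eq)

lemma frag_divide:
  assumes "\<And>i. k dvd Poly_Mapping.lookup x i"
  obtains y where "x = frag_cmul k y" "Poly_Mapping.keys y \<subseteq> Poly_Mapping.keys x"
proof
  let ?y = "Poly_Mapping.map (\<lambda>n. n div k) x"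
  have lookup: "Poly_Mapping.lookup ?y i = Poly_Mapping.lookup x i div k" for i
    by (simp add: Poly_Mapping.map.rep_eq when_def)
  show "x = frag_cmul k ?y"
    by (rule poly_mapping_eqI) (simp add: lookup assms)
  show "Poly_Mapping.keys ?y \<subseteq> Poly_Mapping.keys x"
    by (auto simp: in_keys_iff lookup)
qed

lemma keys_add_subset:
  "Poly_Mapping.keys x \<subseteq> S \<Longrightarrow> Poly_Mapping.keys y \<subseteq> S \<Longrightarrow> Poly_Mapping.keys (x + y) \<subseteq> S"
  using keys_add[of x y] by blast

lemma keys_diff_subset:
  "Poly_Mapping.keys x \<subseteq> S \<Longrightarrow> Poly_Mapping.keys y \<subseteq> S \<Longrightarrow> Poly_Mapping.keys (x - y) \<subseteq> S"
  using keys_diff[of x y] by blast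

lemma keys_cmul_subset: "Poly_Mapping.keys x \<subseteq> S \<Longrightarrow> Poly_Mapping.keys (frag_cmul a x) \<subseteq> S"
  using keys_cmul[of a x] by blast

lemma hom_frag_extend:
  assumes "\<And>i. i \<in> S \<Longrightarrow> Poly_Mapping.keys (f i) \<subseteq> T"
  shows "frag_extend f \<in> hom (free_Abelian_group S) (free_Abelian_group T)"
  using assms keys_frag_extend[of f] by (fastforce simp: hom_def frag_extend_add)

section \<open>The lattice of an Eulerian digraph\<close>

definition laplacian :: "('a, 'b) pre_digraph \<Rightarrow> ('a \<Rightarrow>\<^sub>0 int) \<Rightarrow> ('a \<Rightarrow>\<^sub>0 int)" where
  "laplacian G = frag_extend (vertex_laplacian G)"

lemma laplacian_simps [simp]:
  "laplacian G 0 = 0"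
  "laplacian G (frag_of v) = vertex_laplacian G v"
  "laplacian G (x + y) = laplacian G x + laplacian G y"
  "laplacian G (x - y) = laplacian G x - laplacian G y"
  "laplacian G (frag_cmul a x) = frag_cmul a (laplacian G x)"
  by (simp_all add: laplacian_def frag_extend_add frag_extend_diff frag_extend_cmul)

context fin_digraph
begin

lemma keys_vertex_laplacian:
  assumes "v \<in> verts G"
  shows "Poly_Mapping.keys (vertex_laplacian G v) \<subseteq> verts G"
  unfolding vertex_laplacian_def
  by (intro order_trans[OF keys_sum] UN_least order_trans[OF keys_diff]) (use assms in auto)

lemma keys_laplacian:
  assumes "Poly_Mapping.keys c \<subseteq> verts G"
  shows "Poly_Mapping.keys (laplacian G c) \<subseteq> verts G"
  unfolding laplacian_def
  using keys_frag_extend[of "vertex_laplacian G" c] keys_vertex_laplacian assms by blast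

text \<open>
  Over all vertices together, \<open>v\<close> is added once for each arc into it and subtracted once for each
  arc out of it.
\<close>

lemma sum_vertex_laplacian_eulerian:
  assumes "eulerian_digraph G"
  shows "(\<Sum>v\<in>verts G. vertex_laplacian G v) = 0"
proof -
  have "(\<Sum>v\<in>verts G. \<Sum>e\<in>out_arcs G v. frag_of (head G e)) = (\<Sum>e\<in>arcs G. frag_of (head G e))"
    using sum.group[of "arcs G" "verts G" "tail G" "\<lambda>e. frag_of (head G e)"]
    by (auto simp: out_arcs_def image_subset_iff)
  also have "\<dots> = (\<Sum>v\<in>verts G. \<Sum>e\<in>in_arcs G v. frag_of (head G e))"
    using sum.group[of "arcs G" "verts G" "head G" "\<lambda>e. frag_of (head G e)"]
    by (auto simp: in_arcs_def image_subset_iff)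
  also have "\<dots> = (\<Sum>v\<in>verts G. frag_cmul (int (in_degree G v)) (frag_of v))"
    by (intro sum.cong refl) (simp add: in_degree_def flip: sum_const_frag)
  also have "\<dots> = (\<Sum>v\<in>verts G. \<Sum>e\<in>out_arcs G v. frag_of v)"
    using assms by (intro sum.cong refl) (simp add: eulerian_digraph_def out_degree_def sum_const_frag)
  finally show ?thesis
    by (simp add: vertex_laplacian_def sum_subtractf)
qed

lemma subgroup_sandpile_lattice:
  assumes "r \<in> verts G"
  shows "subgroup (sandpile_lattice G r) (free_Abelian_group (verts G))"
  unfolding sandpile_lattice_def
  using assms keys_vertex_laplacian
  by (intro group.generate_is_subgroup group_free_Abelian_group) auto

lemma normal_sandpile_lattice:
  assumes "r \<in> verts G"
  shows "sandpile_lattice G r \<lhd> free_Abelian_group (verts G)"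
  by (intro comm_group.subgroup_imp_normal abelian_free_Abelian_group
      subgroup_sandpile_lattice assms)

text \<open>The Laplacian at the root is minus the sum of all the others.\<close>

lemma vertex_laplacian_in_lattice:
  assumes "eulerian_digraph G" "r \<in> verts G" "v \<in> verts G"
  shows "vertex_laplacian G v \<in> sandpile_lattice G r"
proof (cases "v = r")
  case False
  then show ?thesis
    using assms unfolding sandpile_lattice_def by (auto intro: generate.incl)
next
  case True
  interpret subgroup "sandpile_lattice G r" "free_Abelian_group (verts G)"
    using assms(2) by (rule subgroup_sandpile_lattice)
  have "(\<Sum>v\<in>A. vertex_laplacian G v) \<in> sandpile_lattice G r" if "A \<subseteq> verts G - {r}" for A
    using that
  proof (induction A rule: infinite_finite_induct)
    case (insert v A)
    then have "vertex_laplacian G v \<in> sandpile_lattice G r"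
      unfolding sandpile_lattice_def by (auto intro: generate.incl)
    with insert show ?case using m_closed by auto
  qed (use one_closed in auto)
  then have others: "(\<Sum>v\<in>verts G - {r}. vertex_laplacian G v) \<in> sandpile_lattice G r"
    by simp
  have "inv\<^bsub>free_Abelian_group (verts G)\<^esub> (\<Sum>v\<in>verts G - {r}. vertex_laplacian G v)
      = - (\<Sum>v\<in>verts G - {r}. vertex_laplacian G v)"
    using mem_carrier[OF others] by simp
  then have "- (\<Sum>v\<in>verts G - {r}. vertex_laplacian G v) \<in> sandpile_lattice G r"
    using m_inv_closed[OF others] by metis
  moreover have "vertex_laplacian G r + (\<Sum>v\<in>verts G - {r}. vertex_laplacian G v) = 0"
    using assms sum_vertex_laplacian_eulerian sum.remove[of "verts G" r "vertex_laplacian G"] by simp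
  ultimately show ?thesis
    using True by (metis eq_neg_iff_add_eq_0)
qed

text \<open>
  This inclusion is stated separately because the line digraph of an Eulerian digraph is in general
  not Eulerian: its in-degree at an arc is the in-degree of the tail, its out-degree the out-degree of
  the head.
\<close>

lemma sandpile_lattice_subset:
  assumes "r \<in> verts G"
  shows "sandpile_lattice G r
    \<subseteq> {frag_cmul a (frag_of r) + laplacian G c |a c. Poly_Mapping.keys c \<subseteq> verts G}" (is "_ \<subseteq> ?S")
  unfolding sandpile_lattice_def
proof (rule group.generate_subgroup_incl[OF group_free_Abelian_group])
  have "frag_of r \<in> ?S"
    by (intro CollectI exI[of _ 1] exI[of _ 0]) simp
  moreover have "vertex_laplacian G v \<in> ?S" if "v \<in> verts G" for v
    using that by (intro CollectI exI[of _ 0] exI[of _ "frag_of v"]) simp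
  ultimately show "insert (frag_of r) (vertex_laplacian G ` (verts G - {r})) \<subseteq> ?S"
    by auto
  have carrier: "?S \<subseteq> carrier (free_Abelian_group (verts G))"
  proof clarify
    fix a and c :: "'a \<Rightarrow>\<^sub>0 int"
    assume "Poly_Mapping.keys c \<subseteq> verts G"
    then have "Poly_Mapping.keys (frag_cmul a (frag_of r) + laplacian G c) \<subseteq> verts G"
      using assms by (intro keys_add_subset keys_cmul_subset keys_laplacian) auto
    then show "frag_cmul a (frag_of r) + laplacian G c \<in> carrier (free_Abelian_group (verts G))"
      by simp
  qed
  show "subgroup ?S (free_Abelian_group (verts G))"
  proof (rule group.subgroupI[OF group_free_Abelian_group])
    show "?S \<subseteq> carrier (free_Abelian_group (verts G))"
      by (rule carrier)
    show "?S \<noteq> {}"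
      using \<open>frag_of r \<in> ?S\<close> by blast
  next
    fix x assume "x \<in> ?S"
    then obtain a c where x: "x = frag_cmul a (frag_of r) + laplacian G c"
      and c: "Poly_Mapping.keys c \<subseteq> verts G" by blast
    have "inv\<^bsub>free_Abelian_group (verts G)\<^esub> x = - x"
      using subsetD[OF carrier \<open>x \<in> ?S\<close>] by simp
    also have "\<dots> = frag_cmul (- a) (frag_of r) + laplacian G (- c)"
      unfolding x minus_frag_cmul[symmetric] by (simp add: laplacian_def frag_extend_minus)
    finally have "inv\<^bsub>free_Abelian_group (verts G)\<^esub> x = \<dots>" .
    moreover have "Poly_Mapping.keys (- c) \<subseteq> verts G"
      using c by simp
    ultimately show "inv\<^bsub>free_Abelian_group (verts G)\<^esub> x \<in> ?S"
      by blast
  next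
    fix x y assume "x \<in> ?S" "y \<in> ?S"
    then obtain a c b d where *: "x = frag_cmul a (frag_of r) + laplacian G c"
      "Poly_Mapping.keys c \<subseteq> verts G" "y = frag_cmul b (frag_of r) + laplacian G d"
      "Poly_Mapping.keys d \<subseteq> verts G" by blast
    then have "x + y = frag_cmul (a + b) (frag_of r) + laplacian G (c + d)"
      by (simp add: frag_cmul_distrib)
    moreover have "Poly_Mapping.keys (c + d) \<subseteq> verts G"
      using * by (intro keys_add_subset)
    ultimately show "x \<otimes>\<^bsub>free_Abelian_group (verts G)\<^esub> y \<in> ?S"
      unfolding mult_free_Abelian_group by blast
  qed
qed

lemma sandpile_lattice_eulerian:
  assumes "eulerian_digraph G" "r \<in> verts G"
  shows "sandpile_lattice G r
    = {frag_cmul a (frag_of r) + laplacian G c |a c. Poly_Mapping.keys c \<subseteq> verts G}"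
proof (rule subset_antisym[OF sandpile_lattice_subset[OF assms(2)]], rule subsetI)
  let ?L = "sandpile_lattice G r"
  interpret subgroup ?L "free_Abelian_group (verts G)"
    using assms(2) by (rule subgroup_sandpile_lattice)
  have diff: "x - y \<in> ?L" if "x \<in> ?L" "y \<in> ?L" for x y
  proof -
    have "x \<otimes>\<^bsub>free_Abelian_group (verts G)\<^esub> inv\<^bsub>free_Abelian_group (verts G)\<^esub> y = x - y"
      using mem_carrier[OF that(2)] by simp
    then show ?thesis
      using m_closed[OF that(1) m_inv_closed[OF that(2)]] by metis
  qed
  have zero: "0 \<in> ?L" using one_closed by simp
  fix x assume "x \<in> {frag_cmul a (frag_of r) + laplacian G c |a c. Poly_Mapping.keys c \<subseteq> verts G}"
  then obtain a c where x: "x = frag_cmul a (frag_of r) + laplacian G c"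
    and c: "Poly_Mapping.keys c \<subseteq> verts G" by blast
  have "frag_of r \<in> ?L"
    unfolding sandpile_lattice_def by (auto intro: generate.incl)
  have "frag_cmul a (frag_of r) \<in> ?L"
    by (rule frag_closure_minus_cmul[where P = "\<lambda>z. z \<in> ?L"]) (use zero diff \<open>frag_of r \<in> ?L\<close> in simp_all)
  moreover have "laplacian G c \<in> ?L"
    using c by (induction c rule: frag_induction)
      (auto simp: zero diff vertex_laplacian_in_lattice assms)
  ultimately show "x \<in> ?L"
    using m_closed x by simp
qed

end

section \<open>The line digraph\<close>

definition out_arc_map :: "('a, 'b) pre_digraph \<Rightarrow> ('a \<Rightarrow>\<^sub>0 int) \<Rightarrow> ('b \<Rightarrow>\<^sub>0 int)" where
  "out_arc_map G = frag_extend (\<lambda>v. \<Sum>e\<in>out_arcs G v. frag_of e)"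

lemma head_map_simps [simp]:
  "head_map G 0 = 0"
  "head_map G (frag_of e) = frag_of (head G e)"
  "head_map G (x + y) = head_map G x + head_map G y"
  "head_map G (x - y) = head_map G x - head_map G y"
  "head_map G (frag_cmul a x) = frag_cmul a (head_map G x)"
  by (simp_all add: head_map_def frag_extend_add frag_extend_diff frag_extend_cmul)

lemma out_arc_map_simps [simp]:
  "out_arc_map G 0 = 0"
  "out_arc_map G (frag_of v) = (\<Sum>e\<in>out_arcs G v. frag_of e)"
  "out_arc_map G (x + y) = out_arc_map G x + out_arc_map G y"
  "out_arc_map G (x - y) = out_arc_map G x - out_arc_map G y"
  "out_arc_map G (frag_cmul a x) = frag_cmul a (out_arc_map G x)"
  by (simp_all add: out_arc_map_def frag_extend_add frag_extend_diff frag_extend_cmul)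

lemma verts_line_digraph [simp]: "verts (line_digraph G) = arcs G"
  by (simp add: line_digraph_def)

lemma out_arcs_line_digraph:
  assumes "e \<in> arcs G"
  shows "out_arcs (line_digraph G) e = Pair e ` out_arcs G (head G e)"
  using assms by (auto simp: out_arcs_def line_digraph_def)

lemma in_arcs_line_digraph:
  assumes "e \<in> arcs G"
  shows "in_arcs (line_digraph G) e = (\<lambda>f. (f, e)) ` in_arcs G (tail G e)"
  using assms by (auto simp: in_arcs_def line_digraph_def)

text \<open>
  The degrees of the line digraph at an arc are the in-degree of the tail and the out-degree of the
  head, both equal to \<open>k\<close>.
\<close>

lemma eulerian_line_digraph:
  assumes "wf_digraph G" "balanced_regular k G"
  shows "eulerian_digraph (line_digraph G)"
  using assms
  by (auto simp: eulerian_digraph_def in_degree_def out_degree_def balanced_regular_def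
      in_arcs_line_digraph out_arcs_line_digraph card_image inj_on_def
      wf_digraph.head_in_verts wf_digraph.tail_in_verts)

context fin_digraph
begin

lemma fin_digraph_line_digraph: "fin_digraph (line_digraph G)"
proof
  have "arcs (line_digraph G) \<subseteq> arcs G \<times> arcs G"
    by (auto simp: line_digraph_def)
  then show "finite (arcs (line_digraph G))"
    by (rule finite_subset) simp
qed (auto simp: line_digraph_def)

lemma keys_head_map:
  assumes "Poly_Mapping.keys x \<subseteq> arcs G"
  shows "Poly_Mapping.keys (head_map G x) \<subseteq> verts G"
  unfolding head_map_def
  using keys_frag_extend[of "\<lambda>e. frag_of (head G e)" x] assms by fastforce

lemma keys_out_arc_map: "Poly_Mapping.keys (out_arc_map G w) \<subseteq> arcs G"
proof -
  have "Poly_Mapping.keys (\<Sum>e\<in>out_arcs G v. frag_of e) \<subseteq> arcs G" for v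
    by (rule order_trans[OF keys_sum]) auto
  then show ?thesis
    unfolding out_arc_map_def by (blast dest: subsetD[OF keys_frag_extend])
qed

text \<open>An arc leaves exactly one vertex, so only that vertex contributes to its coefficient.\<close>

lemma lookup_out_arc_map:
  assumes "e \<in> arcs G"
  shows "Poly_Mapping.lookup (out_arc_map G w) e = Poly_Mapping.lookup w (tail G e)"
  using subset_UNIV
proof (induction w rule: frag_induction)
  case (one v)
  then show ?case
    using assms by (auto simp: lookup_sum lookup_single when_def finite_out_arcs)
qed (auto simp: lookup_minus)

lemma vertex_laplacian_line_digraph:
  assumes "e \<in> arcs G"
  shows "vertex_laplacian (line_digraph G) e
    = out_arc_map G (frag_of (head G e)) - frag_cmul (out_degree G (head G e)) (frag_of e)"
  unfolding vertex_laplacian_def out_arcs_line_digraph[OF assms]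
  by (simp add: sum.reindex inj_on_def line_digraph_def sum_subtractf sum_const_frag
      out_degree_def card_image)

lemma vertex_laplacian_eq:
  "vertex_laplacian G v
    = head_map G (out_arc_map G (frag_of v)) - frag_cmul (out_degree G v) (frag_of v)"
  unfolding vertex_laplacian_def
  by (simp add: head_map_def frag_extend_sum finite_out_arcs sum_subtractf sum_const_frag out_degree_def)

lemma head_map_laplacian_line_digraph:
  assumes "Poly_Mapping.keys c \<subseteq> arcs G"
  shows "head_map G (laplacian (line_digraph G) c) = laplacian G (head_map G c)"
  using assms
proof (induction c rule: frag_induction)
  case (one e)
  then show ?case
    by (simp add: vertex_laplacian_line_digraph vertex_laplacian_eq del: out_arc_map_simps(2))
qed auto

lemma laplacian_line_digraph_regular:
  assumes "balanced_regular k G" "Poly_Mapping.keys c \<subseteq> arcs G"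
  shows "laplacian (line_digraph G) c = out_arc_map G (head_map G c) - frag_cmul k c"
  using assms(2)
proof (induction c rule: frag_induction)
  case (one e)
  with assms(1) show ?case
    by (simp add: vertex_laplacian_line_digraph balanced_regular_def)
qed (auto simp: frag_cmul_diff_distrib2)

lemma laplacian_regular:
  assumes "balanced_regular k G" "Poly_Mapping.keys w \<subseteq> verts G"
  shows "laplacian G w = head_map G (out_arc_map G w) - frag_cmul k w"
  using assms(2)
proof (induction w rule: frag_induction)
  case (one v)
  with assms(1) show ?case
    by (simp add: vertex_laplacian_eq balanced_regular_def del: out_arc_map_simps(2))
qed (auto simp: frag_cmul_diff_distrib2)

lemma head_map_image_lattice:
  assumes "eulerian_digraph G" "r \<in> arcs G"
  shows "head_map G ` sandpile_lattice (line_digraph G) r \<subseteq> sandpile_lattice G (head G r)"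
proof -
  interpret line: fin_digraph "line_digraph G"
    by (rule fin_digraph_line_digraph)
  show ?thesis
  proof
    fix y assume "y \<in> head_map G ` sandpile_lattice (line_digraph G) r"
    then obtain a c where y: "y = head_map G (frag_cmul a (frag_of r) + laplacian (line_digraph G) c)"
      and c: "Poly_Mapping.keys c \<subseteq> arcs G"
      using line.sandpile_lattice_subset[of r] assms(2) unfolding verts_line_digraph by blast
    have "y = frag_cmul a (frag_of (head G r)) + laplacian G (head_map G c)"
      by (simp add: y head_map_laplacian_line_digraph c)
    then show "y \<in> sandpile_lattice G (head G r)"
      unfolding sandpile_lattice_eulerian[OF assms(1) head_in_verts[OF assms(2)]]
      using keys_head_map[OF c] by blast
  qed
qed

text \<open>
  The linear map into the free group on one generator that sends every basis element to that
  generator adds up the coefficients, and every summand of a Laplacian is a difference of two basis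
  elements.
\<close>

lemma sum_coefficients_laplacian: "frag_extend (\<lambda>_. frag_of ()) (laplacian G c) = 0"
proof -
  have "frag_extend (\<lambda>_. frag_of ()) (vertex_laplacian G v) = 0" for v
    by (simp add: vertex_laplacian_def frag_extend_sum finite_out_arcs frag_extend_diff)
  then show ?thesis
    by (simp add: laplacian_def frag_extend_frag_extend frag_extend_eq_0)
qed

text \<open>
  Both directions rest on comparing the compositions of the two maps between vertices and arcs
  with the Laplacians, \<open>\<sigma> \<circ> \<phi> = \<Delta>\<^sub>E + k\<close> and \<open>\<phi> \<circ> \<sigma> = \<Delta>\<^sub>V + k\<close>.  The harder one is to cancel \<open>k\<close>: it
  needs both the root coefficient and \<open>\<phi> c\<close> to be divisible by \<open>k\<close>.
\<close>

lemma head_map_in_lattice_iff: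
  assumes k: "k > 0" and regular: "balanced_regular k G"
    and r: "r \<in> arcs G" and x: "Poly_Mapping.keys x \<subseteq> arcs G"
  shows "head_map G x \<in> sandpile_lattice G (head G r)
    \<longleftrightarrow> frag_cmul k x \<in> sandpile_lattice (line_digraph G) r"
proof -
  interpret line: fin_digraph "line_digraph G"
    by (rule fin_digraph_line_digraph)
  have eulerian: "eulerian_digraph G"
    using regular by (simp add: eulerian_digraph_def balanced_regular_def)
  note lattice = sandpile_lattice_eulerian[OF eulerian head_in_verts[OF r]]
  have line_lattice: "sandpile_lattice (line_digraph G) r
      = {frag_cmul a (frag_of r) + laplacian (line_digraph G) c |a c. Poly_Mapping.keys c \<subseteq> arcs G}"
    using line.sandpile_lattice_eulerian[OF eulerian_line_digraph[OF wf_digraph_axioms regular]] r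
    by simp
  show ?thesis
  proof
    assume "head_map G x \<in> sandpile_lattice G (head G r)"
    then obtain a u where hx: "head_map G x = frag_cmul a (frag_of (head G r)) + laplacian G u"
      and u: "Poly_Mapping.keys u \<subseteq> verts G"
      unfolding lattice by blast
    \<comment> \<open>Solve \<open>\<sigma> (\<phi> x) = \<sigma> (a v + \<Delta>\<^sub>V u)\<close> for \<open>k x\<close> and collect everything under \<open>\<Delta>\<^sub>E\<close>.\<close>
    let ?c = "frag_cmul a (frag_of r) + out_arc_map G u - x"
    have c: "Poly_Mapping.keys ?c \<subseteq> arcs G"
      using x r by (intro keys_diff_subset keys_add_subset keys_cmul_subset keys_out_arc_map) auto
    have "frag_cmul k x = frag_cmul (a * k) (frag_of r) + laplacian (line_digraph G) ?c"
      unfolding laplacian_line_digraph_regular[OF regular c]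
      by (simp add: hx laplacian_regular[OF regular u] frag_cmul_diff_distrib2 frag_cmul_distrib2
          mult.commute del: out_arc_map_simps(2))
    then show "frag_cmul k x \<in> sandpile_lattice (line_digraph G) r"
      unfolding line_lattice using c by (intro CollectI exI[of _ "a * k"] exI[of _ ?c] conjI)
  next
    assume "frag_cmul k x \<in> sandpile_lattice (line_digraph G) r"
    then obtain a c where kx: "frag_cmul k x = frag_cmul a (frag_of r) + laplacian (line_digraph G) c"
      and c: "Poly_Mapping.keys c \<subseteq> arcs G"
      unfolding line_lattice by blast
    \<comment> \<open>Comparing sums of coefficients shows that \<open>k\<close> divides the coefficient of the root.\<close>
    define b where "b = Poly_Mapping.lookup (frag_extend (\<lambda>_. frag_of ()) x) ()"
    have sums: "frag_cmul k (frag_extend (\<lambda>_. frag_of ()) x) = frag_cmul a (frag_of ())"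
      using arg_cong[OF kx, of "frag_extend (\<lambda>_. frag_of ())"]
      by (simp add: frag_extend_add frag_extend_cmul line.sum_coefficients_laplacian)
    have a: "a = k * b"
      using arg_cong[OF sums, of "\<lambda>z. Poly_Mapping.lookup z ()"] by (simp add: b_def)
    have eq: "frag_cmul k (x + c - frag_cmul b (frag_of r)) = out_arc_map G (head_map G c)"
      using kx unfolding laplacian_line_digraph_regular[OF regular c] a
      by (simp add: frag_cmul_diff_distrib2 frag_cmul_distrib2)
    \<comment> \<open>Since \<open>k > 0\<close>, every vertex is the tail of an arc, where \<open>eq\<close> exhibits its coefficient as a
      multiple of \<open>k\<close>.\<close>
    have "int k dvd Poly_Mapping.lookup (head_map G c) v" for v
    proof (cases "v \<in> verts G")
      case True
      with regular k have "out_arcs G v \<noteq> {}"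
        by (auto simp: balanced_regular_def out_degree_def)
      then obtain e where "e \<in> out_arcs G v"
        by blast
      then have e: "e \<in> arcs G" "tail G e = v"
        by auto
      then have "Poly_Mapping.lookup (head_map G c) v
          = Poly_Mapping.lookup (frag_cmul k (x + c - frag_cmul b (frag_of r))) e"
        by (simp add: eq lookup_out_arc_map)
      then show ?thesis by simp
    next
      case False
      then have "v \<notin> Poly_Mapping.keys (head_map G c)"
        using keys_head_map[OF c] by blast
      then show ?thesis by (simp add: in_keys_iff)
    qed
    then obtain u where hc: "head_map G c = frag_cmul k u"
      and "Poly_Mapping.keys u \<subseteq> Poly_Mapping.keys (head_map G c)"
      by (rule frag_divide)
    then have u: "Poly_Mapping.keys u \<subseteq> verts G"
      using keys_head_map[OF c] by blast
    have "x + c - frag_cmul b (frag_of r) = out_arc_map G u"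
      by (rule frag_cmul_cancel[of "int k"]) (use k eq in \<open>simp_all add: hc\<close>)
    then have "x = out_arc_map G u + frag_cmul b (frag_of r) - c"
      by (simp add: algebra_simps)
    then have "head_map G x = frag_cmul b (frag_of (head G r)) + laplacian G u"
      by (simp add: hc laplacian_regular[OF regular u])
    then show "head_map G x \<in> sandpile_lattice G (head G r)"
      unfolding lattice using u by (intro CollectI exI[of _ b] exI[of _ u] conjI)
  qed
qed

end

section \<open>The induced homomorphism\<close>

text \<open>
  A walk from the head of \<open>r\<close> to a vertex either is empty, so that the vertex is the head of \<open>r\<close>, or
  ends with an arc into the vertex.
\<close>

lemma (in fin_digraph) head_map_surj:
  assumes "strongly_connected G" "r \<in> arcs G"
  shows "head_map G ` carrier (free_Abelian_group (arcs G)) = carrier (free_Abelian_group (verts G))"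
proof (intro subset_antisym subsetI)
  have "\<exists>e\<in>arcs G. head G e = v" if "v \<in> verts G" for v
  proof -
    have "head G r \<rightarrow>\<^sup>* v"
      using assms that by (auto simp: strongly_connected_def)
    then show ?thesis
      by (cases rule: reachable_induct) (use assms(2) in \<open>auto simp: arcs_ends_def arc_to_ends_def\<close>)
  qed
  then obtain g where g: "\<And>v. v \<in> verts G \<Longrightarrow> g v \<in> arcs G \<and> head G (g v) = v"
    by metis
  fix w assume "w \<in> carrier (free_Abelian_group (verts G))"
  then have w: "Poly_Mapping.keys w \<subseteq> verts G" by simp
  let ?x = "frag_extend (\<lambda>v. frag_of (g v)) w"
  have "head_map G ?x = frag_extend frag_of w"
    unfolding head_map_def frag_extend_frag_extend using g w by (intro frag_extend_eq) auto
  then have "head_map G ?x = w"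
    by (simp only: frag_expansion[symmetric])
  moreover have "Poly_Mapping.keys ?x \<subseteq> arcs G"
    using keys_frag_extend[of "\<lambda>v. frag_of (g v)" w] g w by fastforce
  ultimately show "w \<in> head_map G ` carrier (free_Abelian_group (arcs G))"
    by (intro image_eqI[of _ _ ?x]) auto
qed (auto dest: subsetD[OF keys_head_map])

lemma (in group) rcoset_eq_self_iff:
  assumes "subgroup H G" "x \<in> carrier G"
  shows "H #> x = H \<longleftrightarrow> x \<in> H"
  using assms coset_join1 coset_join2 by metis

lemma FactGroup_induced_epi:
  assumes h: "h \<in> hom G H" and surj: "h ` carrier G = carrier H"
    and N: "N \<lhd> G" and M: "M \<lhd> H" and NM: "h ` N \<subseteq> M"
  obtains \<psi> where "\<psi> \<in> epi (G Mod N) (H Mod M)"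
    "\<And>x. x \<in> carrier G \<Longrightarrow> \<psi> (N #>\<^bsub>G\<^esub> x) = M #>\<^bsub>H\<^esub> h x"
    "kernel (G Mod N) (H Mod M) \<psi> = {N #>\<^bsub>G\<^esub> x |x. x \<in> carrier G \<and> h x \<in> M}"
proof -
  interpret N: normal N G by (rule N)
  interpret M: normal M H by (rule M)
  have coset: "M #>\<^bsub>H\<^esub> y = M \<longleftrightarrow> y \<in> M" if "y \<in> carrier H" for y
    using M.rcoset_eq_self_iff[OF M.subgroup_axioms that] .
  have h_closed: "h x \<in> carrier H" if "x \<in> carrier G" for x
    using surj that by blast
  have hom: "(\<lambda>x. M #>\<^bsub>H\<^esub> h x) \<in> hom G (H Mod M)"
    using hom_compose[OF h M.r_coset_hom_Mod] by (simp add: comp_def)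
  interpret group_hom G "H Mod M" "\<lambda>x. M #>\<^bsub>H\<^esub> h x"
    by (intro group_hom.intro group_hom_axioms.intro N.is_group M.factorgroup_is_group hom)
  have "N \<subseteq> kernel G (H Mod M) (\<lambda>x. M #>\<^bsub>H\<^esub> h x)"
  proof
    fix x assume "x \<in> N"
    moreover from this have "h x \<in> M"
      using NM by blast
    ultimately show "x \<in> kernel G (H Mod M) (\<lambda>x. M #>\<^bsub>H\<^esub> h x)"
      using N.mem_carrier M.mem_carrier by (simp add: kernel_def coset)
  qed
  then obtain \<psi> where \<psi>: "\<psi> \<in> hom (G Mod N) (H Mod M)"
    "\<And>x. x \<in> carrier G \<Longrightarrow> \<psi> (N #>\<^bsub>G\<^esub> x) = M #>\<^bsub>H\<^esub> h x"
    using FactGroup_universal_kernel[OF N] by blast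
  show thesis
  proof (rule that)
    have "\<psi> ` carrier (G Mod N) = carrier (H Mod M)"
      by (simp add: carrier_FactGroup image_image \<psi>(2) flip: surj)
    with \<psi>(1) show "\<psi> \<in> epi (G Mod N) (H Mod M)"
      by (simp add: epi_def)
    have "\<psi> (N #>\<^bsub>G\<^esub> x) = \<one>\<^bsub>H Mod M\<^esub> \<longleftrightarrow> h x \<in> M" if "x \<in> carrier G" for x
      by (simp add: \<psi>(2) coset h_closed that)
    then show "kernel (G Mod N) (H Mod M) \<psi> = {N #>\<^bsub>G\<^esub> x |x. x \<in> carrier G \<and> h x \<in> M}"
      by (auto simp: kernel_def carrier_FactGroup simp del: one_FactGroup)
  qed (rule \<psi>(2))
qed

theorem theorem1p2:
  fixes G :: "('a, 'b) pre_digraph" and e_root :: 'b and v_root :: 'a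
  assumes "fin_digraph G"
    and "strongly_connected G"
    and "eulerian_digraph G"
    and "e_root \<in> arcs G"
    and "v_root = head G e_root"
  shows "head_map G ` sandpile_lattice (line_digraph G) e_root \<subseteq> sandpile_lattice G v_root
    \<and> (\<exists>\<psi>.
         (\<forall>x \<in> carrier (free_Abelian_group (arcs G)).
            \<psi> (sandpile_lattice (line_digraph G) e_root #>\<^bsub>free_Abelian_group (arcs G)\<^esub> x)
              = sandpile_lattice G v_root #>\<^bsub>free_Abelian_group (verts G)\<^esub> head_map G x)
       \<and> \<psi> \<in> epi (sandpile_group (line_digraph G) e_root) (sandpile_group G v_root)
       \<and> (\<forall>k::nat. k > 0 \<and> balanced_regular k G \<longrightarrow>
            kernel (sandpile_group (line_digraph G) e_root) (sandpile_group G v_root) \<psi>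
              = {g \<in> carrier (sandpile_group (line_digraph G) e_root).
                   g [^]\<^bsub>sandpile_group (line_digraph G) e_root\<^esub> k
                     = \<one>\<^bsub>sandpile_group (line_digraph G) e_root\<^esub>}))"
proof -
  interpret fin_digraph G by (rule assms(1))
  interpret line: fin_digraph "line_digraph G" by (rule fin_digraph_line_digraph)
  let ?K = "sandpile_group (line_digraph G) e_root"
  let ?L = "sandpile_lattice (line_digraph G) e_root"
  let ?FE = "free_Abelian_group (arcs G)"
  have image: "head_map G ` ?L \<subseteq> sandpile_lattice G v_root"
    using head_map_image_lattice assms by simp
  have normal: "?L \<lhd> ?FE"
    using line.normal_sandpile_lattice assms(4) by simp
  have normal_root: "sandpile_lattice G v_root \<lhd> free_Abelian_group (verts G)"
    using normal_sandpile_lattice assms by simp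
  have hom: "head_map G \<in> hom ?FE (free_Abelian_group (verts G))"
    unfolding head_map_def by (rule hom_frag_extend) auto
  have surj: "head_map G ` carrier ?FE = carrier (free_Abelian_group (verts G))"
    using head_map_surj assms by blast
  have K: "?K = ?FE Mod ?L"
    by (simp add: sandpile_group_def)
  obtain \<psi> where epi: "\<psi> \<in> epi ?K (sandpile_group G v_root)"
    and apply_coset: "\<And>x. x \<in> carrier ?FE \<Longrightarrow>
        \<psi> (?L #>\<^bsub>?FE\<^esub> x) = sandpile_lattice G v_root #>\<^bsub>free_Abelian_group (verts G)\<^esub> head_map G x"
    and kernel: "kernel ?K (sandpile_group G v_root) \<psi>
        = {?L #>\<^bsub>?FE\<^esub> x |x. x \<in> carrier ?FE \<and> head_map G x \<in> sandpile_lattice G v_root}"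
    using FactGroup_induced_epi[OF hom surj normal normal_root image]
    unfolding sandpile_group_def verts_line_digraph by blast
  have torsion: "kernel ?K (sandpile_group G v_root) \<psi> = {g \<in> carrier ?K. g [^]\<^bsub>?K\<^esub> k = \<one>\<^bsub>?K\<^esub>}"
    if "k > 0" "balanced_regular k G" for k :: nat
  proof -
    have "(?L #>\<^bsub>?FE\<^esub> x) [^]\<^bsub>?K\<^esub> k = \<one>\<^bsub>?K\<^esub> \<longleftrightarrow> head_map G x \<in> sandpile_lattice G v_root"
      if x: "x \<in> carrier ?FE" for x
    proof -
      have kx: "frag_cmul k x \<in> carrier ?FE"
        using x by (simp add: keys_cmul_subset)
      have "(?L #>\<^bsub>?FE\<^esub> x) [^]\<^bsub>?K\<^esub> k = \<one>\<^bsub>?K\<^esub> \<longleftrightarrow> ?L #>\<^bsub>?FE\<^esub> frag_cmul k x = ?L"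
        using x by (simp add: K normal.FactGroup_pow[OF normal])
      also have "\<dots> \<longleftrightarrow> frag_cmul k x \<in> ?L"
        by (rule group.rcoset_eq_self_iff[OF group_free_Abelian_group normal_imp_subgroup[OF normal] kx])
      also have "\<dots> \<longleftrightarrow> head_map G x \<in> sandpile_lattice G v_root"
        using head_map_in_lattice_iff[OF \<open>k > 0\<close> \<open>balanced_regular k G\<close> assms(4)] x assms(5) by simp
      finally show ?thesis .
    qed
    then show ?thesis
      unfolding kernel by (auto simp: K carrier_FactGroup)
  qed
  show ?thesis
    using image epi apply_coset torsion by (intro conjI exI[of _ \<psi>]) simp_all
qed

end
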